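(* Let $a,b,m\in\mathbb{N}$. If $b\mid a$, then $$[q^n]\,F_{a,b,m}(q)\ge0\qquad\text{for all integers }0\le n<a+2m.$$
   Context: $\mathbb{N}$ is the set of positive integers. Notation: $(z;q)_\infty=\prod_{i\ge0}(1-zq^i)$; $[q^n]f$ denotes the coefficient of $q^n$ in the formal power series $f$. For $a,b,m\in\mathbb{N}$, $$F_{a,b,m}(q):=\frac{(-q^{a+b};q^m)_\infty}{(-q^a;q^m)_\infty\,(q^b;q^m)_\infty},$$ regarded as a formal power series in $q$. *)

theory Defs
  imports "HOL-Analysis.Infinite_Products"
    "HOL-Computational_Algebra.Formal_Power_Series"
begin

text \<open>
  The infinite product is taken in the library topology on formal power series, i.e. the
  X-adic one. The base is again a power series, so that \<open>(z; q^m)\<close> is obtained at base \<open>fps_X ^ m\<close>.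
\<close>

definition qpoch_inf :: "rat fps \<Rightarrow> rat fps \<Rightarrow> rat fps" where
  "qpoch_inf z q = prodinf (\<lambda>i. 1 - z * q ^ i)"

text \<open>
  The coefficients are in fact integers; rational coefficients make the library's
  division of power series available. The denominator has constant term 1 when \<open>a, b, m > 0\<close>.
\<close>

definition F :: "nat \<Rightarrow> nat \<Rightarrow> nat \<Rightarrow> rat fps" where
  "F a b m =
     qpoch_inf (- (fps_X ^ (a + b))) (fps_X ^ m) /
       (qpoch_inf (- (fps_X ^ a)) (fps_X ^ m) * qpoch_inf (fps_X ^ b) (fps_X ^ m))"

text \<open>The products in \<open>F\<close> converge, so \<open>prodinf\<close> is not a default value.\<close>

lemma has_prod_qpoch_inf:
  assumes z: "fps_nth z 0 = 0" and q: "fps_nth q 0 = 0"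
  shows "(\<lambda>i. 1 - z * q ^ i) has_prod qpoch_inf z q"
    and "fps_nth (qpoch_inf z q) 0 = 1"
proof -
  define P where "P n = (\<Prod>i\<le>n. 1 - z * q ^ i)" for n
  have low: "fps_nth (z * q ^ i) k = 0" if "k \<le> i" for i k
    unfolding fps_mult_nth
  proof (rule sum.neutral, intro ballI)
    fix j assume "j \<in> {0..k}"
    show "fps_nth z j * fps_nth (q ^ i) (k - j) = 0"
    proof (cases "j = 0")
      case False
      then have "k - j < i" using that \<open>j \<in> {0..k}\<close> by auto
      then show ?thesis using startsby_zero_power_prefix[OF q, of i] by simp
    qed (use z in simp)
  qed
  have step: "fps_nth (P (Suc n)) k = fps_nth (P n) k" if "k \<le> n" for n k
  proof -
    have "fps_nth (P n * (z * q ^ Suc n)) k = 0"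
      unfolding fps_mult_nth[of "P n"]
      by (rule sum.neutral) (use low[of _ "Suc n"] that in \<open>auto simp del: power_Suc\<close>)
    then show ?thesis by (simp add: P_def algebra_simps)
  qed
  have stable: "fps_nth (P n) k = fps_nth (P k) k" if "k \<le> n" for n k
    using that by (induction n rule: dec_induct) (auto simp: step)
  define L where "L = Abs_fps (\<lambda>k. fps_nth (P k) k)"
  have lim: "P \<longlonglongrightarrow> L"
    unfolding tendsto_fps_iff
    by (intro allI) (auto simp: L_def eventually_at_top_linorder intro: stable)
  have L0: "fps_nth L 0 = 1"
    using z by (simp add: L_def P_def)
  then have "L \<noteq> 0" by auto
  with lim have "(\<lambda>i. 1 - z * q ^ i) has_prod L"
    unfolding has_prod_def raw_has_prod_def P_def by simp
  moreover from this have "qpoch_inf z q = L"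
    unfolding qpoch_inf_def by (rule has_prod_unique[symmetric])
  ultimately show "(\<lambda>i. 1 - z * q ^ i) has_prod qpoch_inf z q"
    and "fps_nth (qpoch_inf z q) 0 = 1"
    using L0 by simp_all
qed

end

theory Submission
  imports Defs
begin

text \<open>
  Put \<open>A = (1 + q^(a+b)) / ((1 + q^a) (1 - q^b)) = 1/(1 - q^b) + 1/(1 + q^a) - 1\<close>, which has
  nonnegative coefficients because \<open>b dvd a\<close>, and let \<open>H\<close> be the reciprocal of \<open>(q^(b+m); q^m)\<close>.
  Modulo \<open>q^(a+2m)\<close> the remaining factors of \<open>F\<close> reduce to \<open>1 - q^(a+m) (1 - q^b)\<close>, and
  \<open>H\<close> is 1 modulo \<open>q^m\<close>, so \<open>F\<close> is congruent to \<open>A H - q^(a+m) (1 - q^b) A\<close>. Now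
  \<open>(1 + q^a) (1 - q^b) A = 1 + q^(a+b)\<close> turns this into
  \<open>A (H - 1 - q^(b+m)) + A + q^m (A - 1 - q^(a+b))\<close>, a combination of series with nonnegative
  coefficients.
\<close>

section \<open>Nonnegative power series\<close>

definition nonneg_fps :: "rat fps \<Rightarrow> bool" where
  "nonneg_fps f \<longleftrightarrow> (\<forall>n. fps_nth f n \<ge> 0)"

lemma nonneg_fps_add: "nonneg_fps f \<Longrightarrow> nonneg_fps g \<Longrightarrow> nonneg_fps (f + g)"
  by (simp add: nonneg_fps_def)

lemma nonneg_fps_mult: "nonneg_fps f \<Longrightarrow> nonneg_fps g \<Longrightarrow> nonneg_fps (f * g)"
  by (auto simp: nonneg_fps_def fps_mult_nth intro!: sum_nonneg)

lemma nonneg_fps_X_power: "nonneg_fps (fps_X ^ k)"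
  by (simp add: nonneg_fps_def)

text \<open>Congruences modulo a power of \<open>fps_X\<close> are stated as divisibility, where
  ring lemmas apply; this translates them back to coefficients.\<close>

lemma fps_X_power_dvd_iff:
  fixes f :: "rat fps"
  shows "fps_X ^ k dvd f \<longleftrightarrow> (\<forall>i<k. fps_nth f i = 0)"
proof
  assume "fps_X ^ k dvd f"
  then show "\<forall>i<k. fps_nth f i = 0"
    by (auto simp: dvd_def fps_X_power_mult_nth)
next
  assume "\<forall>i<k. fps_nth f i = 0"
  then have "f = fps_X ^ k * fps_shift k f"
    by (auto simp: fps_eq_iff fps_X_power_mult_nth)
  then show "fps_X ^ k dvd f"
    by (rule dvdI)
qed

lemma fps_inverse_unique_right:
  fixes f g :: "rat fps"
  assumes "f * g = 1"
  shows "inverse f = g"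
proof -
  have "fps_nth f 0 \<noteq> 0"
    using arg_cong[OF assms, of "\<lambda>h. fps_nth h 0"] by auto
  then have "inverse f * f = 1"
    by (rule inverse_mult_eq_1)
  then show ?thesis
    using assms by (metis mult.assoc mult.left_neutral mult.right_neutral)
qed

lemma fps_nth_inverse_one_minus_X_power:
  assumes "c > 0"
  shows "fps_nth (inverse (1 - fps_X ^ c :: rat fps)) n = (if c dvd n then 1 else 0)"
proof -
  define E :: "rat fps" where "E = Abs_fps (\<lambda>n. if c dvd n then 1 else 0)"
  have "(1 - fps_X ^ c) * E = 1"
  proof (rule fps_ext)
    fix n
    show "fps_nth ((1 - fps_X ^ c) * E) n = fps_nth 1 n"
      using assms
      by (auto simp: E_def left_diff_distrib fps_X_power_mult_nth dvd_minus_self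
          dest: dvd_imp_le)
  qed
  then have "inverse (1 - fps_X ^ c) = E"
    by (rule fps_inverse_unique_right)
  then show ?thesis
    by (simp add: E_def)
qed

lemma fps_nth_inverse_one_plus_X_power:
  assumes "c > 0"
  shows "fps_nth (inverse (1 + fps_X ^ c :: rat fps)) n =
    (if c dvd n then (- 1) ^ (n div c) else 0)"
proof -
  define E :: "rat fps" where "E = Abs_fps (\<lambda>n. if c dvd n then (- 1) ^ (n div c) else 0)"
  have "(1 + fps_X ^ c) * E = 1"
  proof (rule fps_ext)
    fix n
    show "fps_nth ((1 + fps_X ^ c) * E) n = fps_nth 1 n"
    proof (cases "n < c")
      case True
      then show ?thesis
        using assms by (auto simp: E_def distrib_right fps_X_power_mult_nth dest: dvd_imp_le)
    next
      case False
      then obtain k where "n = c + k"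
        by (metis le_add_diff_inverse linorder_not_less)
      then show ?thesis
        using assms by (auto simp: E_def distrib_right fps_X_power_mult_nth)
    qed
  qed
  then have "inverse (1 + fps_X ^ c) = E"
    by (rule fps_inverse_unique_right)
  then show ?thesis
    by (simp add: E_def)
qed

section \<open>The infinite product\<close>

text \<open>X-adic convergence makes each coefficient of the partial products eventually constant,
  which reduces claims on the limit to finite products.\<close>

lemma eventually_nth_qpoch_inf:
  assumes "fps_nth z 0 = 0" and "fps_nth q 0 = 0"
  shows "\<forall>\<^sub>F n in sequentially.
    fps_nth (\<Prod>i\<le>n. 1 - z * q ^ i) k = fps_nth (qpoch_inf z q) k"
  using has_prod_imp_tendsto[OF has_prod_qpoch_inf(1)[OF assms]]
  by (simp add: tendsto_fps_iff)

text \<open>Each factor is 1 modulo \<open>fps_X ^ c\<close>, hence so is each partial product, and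
  coefficients pass to the limit.\<close>

lemma X_power_dvd_qpoch_inf_minus_one:
  assumes "fps_X ^ c dvd z" and "c > 0" and "fps_nth q 0 = 0"
  shows "fps_X ^ c dvd qpoch_inf z q - 1"
  unfolding fps_X_power_dvd_iff
proof (intro allI impI)
  fix k assume "k < c"
  have "fps_X ^ c dvd (\<Prod>i\<le>n. 1 - z * q ^ i) - 1" for n
  proof (induction n)
    case 0
    then show ?case using assms(1) by simp
  next
    case (Suc n)
    have "(\<Prod>i\<le>Suc n. 1 - z * q ^ i) - 1 =
      ((\<Prod>i\<le>n. 1 - z * q ^ i) - 1) - (\<Prod>i\<le>n. 1 - z * q ^ i) * q ^ Suc n * z"
      by (simp add: algebra_simps)
    then show ?case
      using Suc assms(1) by (metis dvd_diff dvd_mult)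
  qed
  then have part: "fps_nth (\<Prod>i\<le>n. 1 - z * q ^ i) k = fps_nth 1 k" for n
    using \<open>k < c\<close> by (fastforce simp: fps_X_power_dvd_iff)
  have "fps_nth z 0 = 0"
    using assms by (simp add: fps_X_power_dvd_iff)
  from eventually_happens'[OF _ eventually_nth_qpoch_inf[OF this assms(3), of k]]
  show "fps_nth (qpoch_inf z q - 1) k = 0"
    by (auto simp: part)
qed

text \<open>Coefficient \<open>k\<close> of the right side involves only coefficients up to
  \<open>k\<close> of the tail, so one \<open>n\<close> at which all of them have stabilised reduces
  the claim to finite products.\<close>

lemma qpoch_inf_rec:
  assumes "fps_nth z 0 = 0" and "fps_nth q 0 = 0"
  shows "qpoch_inf z q = (1 - z) * qpoch_inf (z * q) q"
proof (rule fps_ext)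
  fix k
  have zq: "fps_nth (z * q) 0 = 0"
    using assms by simp
  have "\<forall>\<^sub>F n in sequentially. \<forall>j\<in>{0..k}.
      fps_nth (\<Prod>i\<le>n. 1 - z * q * q ^ i) j = fps_nth (qpoch_inf (z * q) q) j"
    using eventually_nth_qpoch_inf[OF zq assms(2)] by (simp add: eventually_ball_finite)
  moreover have "\<forall>\<^sub>F n in sequentially.
      fps_nth (\<Prod>i\<le>Suc n. 1 - z * q ^ i) k = fps_nth (qpoch_inf z q) k"
    using eventually_nth_qpoch_inf[OF assms, of k]
      eventually_sequentially_Suc[of "\<lambda>n. fps_nth (\<Prod>i\<le>n. 1 - z * q ^ i) k = fps_nth (qpoch_inf z q) k"]
    by simp
  ultimately have "\<forall>\<^sub>F n in sequentially.
      (\<forall>j\<in>{0..k}. fps_nth (\<Prod>i\<le>n. 1 - z * q * q ^ i) j = fps_nth (qpoch_inf (z * q) q) j) \<and>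
      fps_nth (\<Prod>i\<le>Suc n. 1 - z * q ^ i) k = fps_nth (qpoch_inf z q) k"
    by (rule eventually_conj)
  then obtain n where
    tail: "\<And>j. j \<in> {0..k} \<Longrightarrow>
      fps_nth (\<Prod>i\<le>n. 1 - z * q * q ^ i) j = fps_nth (qpoch_inf (z * q) q) j" and
    full: "fps_nth (\<Prod>i\<le>Suc n. 1 - z * q ^ i) k = fps_nth (qpoch_inf z q) k"
    using eventually_happens' sequentially_bot by blast
  have "(\<Prod>i\<le>Suc n. 1 - z * q ^ i) = (1 - z) * (\<Prod>i\<le>n. 1 - z * q * q ^ i)"
    by (simp add: prod.atMost_Suc_shift mult.assoc del: prod.atMost_Suc)
  then have "fps_nth (qpoch_inf z q) k = fps_nth ((1 - z) * (\<Prod>i\<le>n. 1 - z * q * q ^ i)) k"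
    using full by simp
  also have "\<dots> = fps_nth ((1 - z) * qpoch_inf (z * q) q) k"
    unfolding fps_mult_nth[of "1 - z"] by (intro sum.cong) (simp_all add: tail)
  finally show "fps_nth (qpoch_inf z q) k = fps_nth ((1 - z) * qpoch_inf (z * q) q) k" .
qed

lemma qpoch_inf_rec2:
  assumes "fps_nth z 0 = 0" and "fps_nth q 0 = 0"
  shows "qpoch_inf z q = (1 - z) * (1 - z * q) * qpoch_inf (z * q\<^sup>2) q"
  using qpoch_inf_rec[OF assms] qpoch_inf_rec[of "z * q" q] assms
  by (simp add: power2_eq_square mult.assoc)

text \<open>\<open>T c\<close> generates the partitions into parts \<open>c\<close>,
  \<open>c + m\<close>, \<open>c + 2 * m\<close>, and so on; the summands separate those without a
  part \<open>c\<close> from those with one.\<close>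

lemma inverse_qpoch_inf_rec:
  assumes "c > 0" and "m > 0"
  defines "T \<equiv> \<lambda>c. inverse (qpoch_inf (fps_X ^ c) (fps_X ^ m))"
  shows "T c = T (c + m) + fps_X ^ c * T c"
proof -
  have "T c = inverse (1 - fps_X ^ c) * T (c + m)"
    using qpoch_inf_rec[of "fps_X ^ c" "fps_X ^ m"] assms
    by (simp add: T_def fps_inverse_mult power_add)
  moreover have "(1 - fps_X ^ c) * inverse (1 - fps_X ^ c :: rat fps) = 1"
    by (rule inverse_mult_eq_1') (use assms in simp)
  ultimately have "(1 - fps_X ^ c) * T c = T (c + m)"
    by (metis mult.assoc mult.left_neutral)
  then show ?thesis
    by (simp add: algebra_simps)
qed

lemma X_power_dvd_inverse_minus_one:
  fixes f :: "rat fps"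
  assumes "fps_X ^ c dvd f - 1" and "c > 0"
  shows "fps_X ^ c dvd inverse f - 1"
proof -
  have "fps_nth f 0 \<noteq> 0"
    using assms by (simp add: fps_X_power_dvd_iff)
  then have "inverse f * f = 1"
    by (rule inverse_mult_eq_1)
  then have "inverse f - 1 = (f - 1) * (- inverse f)"
    by (simp add: algebra_simps)
  then show ?thesis
    using assms(1) by (metis dvd_mult2)
qed

lemma nonneg_inverse_qpoch_inf:
  assumes "c > 0" and "m > 0"
  shows "nonneg_fps (inverse (qpoch_inf (fps_X ^ c) (fps_X ^ m)))"
proof -
  define T where "T c = inverse (qpoch_inf (fps_X ^ c) (fps_X ^ m))" for c
  have "fps_nth (T c) k \<ge> 0" if "c > 0" for c k
    using that
  \<comment> \<open>The recursion leads to \<open>(c + m, k)\<close> and \<open>(c, k - c)\<close>,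
    both of smaller measure. The factor 2 keeps the measure positive for \<open>c \<le> k\<close>; a
    truncated \<open>k - c\<close> would already be 0 at \<open>k = c\<close>.\<close>
  proof (induction "2 * k - c" arbitrary: c k rule: less_induct)
    case less
    show ?case
    proof (cases "k < c")
      case True
      have "fps_X ^ c dvd T c - 1"
        unfolding T_def using less.prems assms(2)
        by (intro X_power_dvd_inverse_minus_one X_power_dvd_qpoch_inf_minus_one) auto
      then have "fps_nth (T c) k = fps_nth 1 k"
        using True by (simp add: fps_X_power_dvd_iff)
      then show ?thesis by simp
    next
      case False
      have "fps_nth (T c) k = fps_nth (T (c + m)) k + fps_nth (T c) (k - c)"
        using arg_cong[OF inverse_qpoch_inf_rec[OF less.prems assms(2), folded T_def],
            of "\<lambda>f. fps_nth f k"] False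
        by (simp add: fps_X_power_mult_nth)
      moreover have "fps_nth (T (c + m)) k \<ge> 0"
        by (rule less.hyps) (use False less.prems assms(2) in auto)
      moreover have "fps_nth (T c) (k - c) \<ge> 0"
        by (rule less.hyps) (use False less.prems in auto)
      ultimately show ?thesis by simp
    qed
  qed
  then show ?thesis
    using assms(1) by (simp add: nonneg_fps_def T_def)
qed

section \<open>The truncated product\<close>

text \<open>The \<open>i = 0\<close> factors of the three products in \<open>F\<close>.\<close>

definition head_factor :: "nat \<Rightarrow> nat \<Rightarrow> rat fps" where
  "head_factor a b = (1 + fps_X ^ (a + b)) * inverse (1 + fps_X ^ a) * inverse (1 - fps_X ^ b)"

lemma head_factor_mult:
  assumes "a > 0" and "b > 0"
  shows "(1 + fps_X ^ a) * (1 - fps_X ^ b) * head_factor a b = 1 + fps_X ^ (a + b)"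
proof -
  have "(1 + fps_X ^ a) * inverse (1 + fps_X ^ a :: rat fps) = 1"
    and "(1 - fps_X ^ b) * inverse (1 - fps_X ^ b :: rat fps) = 1"
    using assms by (simp_all add: inverse_mult_eq_1')
  \<comment> \<open>The inverses become variables known only by their defining relations, so that
    \<open>algebra\<close> applies.\<close>
  moreover have "(1 + u) * (1 - w) * (z * iu * iw) = z"
    if "(1 + u) * iu = 1" and "(1 - w) * iw = 1" for u w z iu iw :: "rat fps"
    using that by algebra
  ultimately show ?thesis
    unfolding head_factor_def by blast
qed

text \<open>Partial fractions, from
  \<open>(1 + u) + (1 - w) - (1 + u) * (1 - w) = 1 + u * w\<close>.\<close>

lemma head_factor_eq:
  assumes "a > 0" and "b > 0"
  shows "head_factor a b = inverse (1 - fps_X ^ b) + inverse (1 + fps_X ^ a) - 1"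
proof -
  have "(1 + fps_X ^ a) * inverse (1 + fps_X ^ a :: rat fps) = 1"
    and "(1 - fps_X ^ b) * inverse (1 - fps_X ^ b :: rat fps) = 1"
    using assms by (simp_all add: inverse_mult_eq_1')
  moreover have "(1 + u * w) * iu * iw = iw + iu - 1"
    if "(1 + u) * iu = 1" and "(1 - w) * iw = 1" for u w iu iw :: "rat fps"
    using that by algebra
  ultimately show ?thesis
    unfolding head_factor_def power_add by blast
qed

lemma fps_nth_head_factor:
  assumes "a > 0" and "b > 0"
  shows "fps_nth (head_factor a b) n =
    (if b dvd n then 1 else 0) + (if a dvd n then (- 1) ^ (n div a) else 0)
      - (if n = 0 then 1 else 0)"
  using assms
  by (simp add: head_factor_eq fps_nth_inverse_one_minus_X_power
      fps_nth_inverse_one_plus_X_power)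

text \<open>A coefficient -1 of \<open>inverse (1 + fps_X ^ a)\<close> sits at a multiple of
  \<open>a\<close>, hence of \<open>b\<close>, where the other geometric series contributes 1. At
  the degrees 0 and \<open>a + b\<close> at least 1 remains to be subtracted from.\<close>

lemma nonneg_head_factor_minus:
  assumes "a > 0" and "b > 0" and "b dvd a"
  shows "nonneg_fps (head_factor a b - 1 - fps_X ^ (a + b))"
  unfolding nonneg_fps_def
proof
  fix n
  have sign: "(- 1 :: rat) ^ k \<ge> - 1" for k
    by (cases "even k") auto
  show "fps_nth (head_factor a b - 1 - fps_X ^ (a + b)) n \<ge> 0"
  proof (cases "n = a + b")
    case True
    \<comment> \<open>Here \<open>a dvd n\<close> forces \<open>a = b\<close>, so that \<open>n div a = 2\<close> is even.\<close>
    have "a dvd n \<Longrightarrow> n div a = 2"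
      using True assms by (auto dest: dvd_antisym)
    then show ?thesis
      using True assms by (auto simp: fps_nth_head_factor)
  next
    case False
    then show ?thesis
      using assms sign[of "n div a"] by (auto simp: fps_nth_head_factor intro: dvd_trans)
  qed
qed

lemma nonneg_head_factor:
  assumes "a > 0" and "b > 0" and "b dvd a"
  shows "nonneg_fps (head_factor a b)"
proof -
  \<comment> \<open>Writing 1 as \<open>fps_X ^ 0\<close> brings it under
    \<open>nonneg_fps_X_power\<close>.\<close>
  have "head_factor a b = (head_factor a b - 1 - fps_X ^ (a + b)) + fps_X ^ 0 + fps_X ^ (a + b)"
    by simp
  then show ?thesis
    using nonneg_head_factor_minus[OF assms]
    by (metis nonneg_fps_add nonneg_fps_X_power)
qed

text \<open>Two factors are split off the products involving \<open>a\<close>, whose tails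
  \<open>P\<close> and \<open>Q\<close> are then 1 modulo \<open>u * v\<^sup>2\<close>; one factor
  is split off the third, whose tail \<open>R\<close> is kept.\<close>

lemma F_cong:
  assumes "a > 0" and "b > 0" and "m > 0"
  shows "fps_X ^ (a + 2 * m) dvd F a b m -
    (head_factor a b * inverse (qpoch_inf (fps_X ^ (b + m)) (fps_X ^ m))
      - fps_X ^ (a + m) * (1 - fps_X ^ b) * head_factor a b)"
proof -
  define u v w :: "rat fps" where "u = fps_X ^ a" and "v = fps_X ^ m" and "w = fps_X ^ b"
  have zero: "fps_nth u 0 = 0" "fps_nth v 0 = 0" "fps_nth w 0 = 0"
    using assms by (simp_all add: u_def v_def w_def)
  define P where "P = qpoch_inf (- (u * w * v\<^sup>2)) v"
  define Q where "Q = qpoch_inf (- (u * v\<^sup>2)) v"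
  define R where "R = qpoch_inf (w * v) v"
  define A where "A = head_factor a b"
  have N: "fps_X ^ (a + 2 * m) = u * v\<^sup>2"
    unfolding u_def v_def by (simp add: power_add power_mult[symmetric] mult.commute)
  have dvd_qpoch: "u * v\<^sup>2 dvd qpoch_inf z v - 1" if "u * v\<^sup>2 dvd z" for z
    using that X_power_dvd_qpoch_inf_minus_one[of "a + 2 * m" z v] assms zero by (simp add: N)
  have P: "u * v\<^sup>2 dvd P - 1" and Q: "u * v\<^sup>2 dvd Q - 1"
    unfolding P_def Q_def by (intro dvd_qpoch; simp add: mult_ac)+
  have R: "v dvd inverse R - 1"
    unfolding v_def R_def w_def using assms
    by (intro X_power_dvd_inverse_minus_one X_power_dvd_qpoch_inf_minus_one) auto
  have Q0: "fps_nth Q 0 = 1" and R0: "fps_nth R 0 = 1"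
    unfolding Q_def R_def by (intro has_prod_qpoch_inf(2); simp add: zero)+
  have num: "qpoch_inf (- (u * w)) v = (1 + u * w) * (1 + u * w * v) * P"
    using qpoch_inf_rec2[of "- (u * w)" v] zero by (simp add: P_def)
  have den1: "qpoch_inf (- u) v = (1 + u) * (1 + u * v) * Q"
    using qpoch_inf_rec2[of "- u" v] zero by (simp add: Q_def)
  have den2: "qpoch_inf w v = (1 - w) * R"
    using qpoch_inf_rec[of w v] zero by (simp add: R_def)
  define C where "C = (1 + u * w * v) * P * (inverse (1 + u * v) * inverse Q)"
  have "F a b m = qpoch_inf (- (u * w)) v / (qpoch_inf (- u) v * qpoch_inf w v)"
    by (simp add: F_def u_def v_def w_def power_add)
  also have "\<dots> = A * inverse R * C"
    unfolding num den1 den2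
    by (subst fps_divide_unit)
      (simp_all add: zero Q0 R0 A_def C_def head_factor_def fps_inverse_mult power_add
        u_def[symmetric] w_def[symmetric] mult_ac)
  finally have F: "F a b m = A * inverse R * C" .
  have inv: "(1 + u * v) * inverse (1 + u * v) = 1" "Q * inverse Q = 1"
    by (simp_all add: inverse_mult_eq_1' zero Q0)
  \<comment> \<open>With \<open>P\<close> and \<open>Q\<close> replaced by 1, the numerator is
    \<open>(1 + u * w * v) - (1 - u * v * (1 - w)) * (1 + u * v)\<close>, which equals
    \<open>u\<^sup>2 * v\<^sup>2 * (1 - w)\<close>.\<close>
  have "C - (1 - u * v * (1 - w)) =
    ((1 + u * w * v) * (P - 1) - (1 - u * v * (1 - w)) * (1 + u * v) * (Q - 1)
      + u * v\<^sup>2 * (u * (1 - w))) * (inverse (1 + u * v) * inverse Q)"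
    unfolding C_def using inv by algebra
  also have "u * v\<^sup>2 dvd \<dots>"
    by (intro dvd_mult2 dvd_add dvd_diff dvd_triv_left dvd_mult P Q)
  finally have C: "u * v\<^sup>2 dvd C - (1 - u * v * (1 - w))" .
  \<comment> \<open>The correction term already carries \<open>u * v\<close>, so
    \<open>inverse R\<close> may be replaced by 1 there, being 1 modulo \<open>v\<close>.\<close>
  have "u * v\<^sup>2 dvd A * u * (1 - w) * (v * (inverse R - 1))"
    using R mult_dvd_mono[of "u * v" "A * u * (1 - w) * v" v "inverse R - 1"]
    by (simp add: power2_eq_square mult_ac)
  moreover have "u * v\<^sup>2 dvd A * inverse R * (C - (1 - u * v * (1 - w)))"
    by (intro dvd_mult C)
  ultimately have "u * v\<^sup>2 dvd A * inverse R * (C - (1 - u * v * (1 - w)))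
      - A * u * (1 - w) * (v * (inverse R - 1))"
    by (rule dvd_diff[rotated])
  also have "\<dots> = F a b m - (A * inverse R - u * v * (1 - w) * A)"
    unfolding F by (simp add: algebra_simps)
  finally show ?thesis
    unfolding N by (simp add: A_def R_def u_def v_def w_def power_add mult_ac)
qed

text \<open>Only degrees 0 and \<open>c\<close> are lowered. The constant term is 1, and the
  recursion carries it into degree \<open>c\<close>.\<close>

lemma nonneg_inverse_qpoch_inf_minus:
  assumes "c > 0" and "m > 0"
  shows "nonneg_fps (inverse (qpoch_inf (fps_X ^ c) (fps_X ^ m)) - 1 - fps_X ^ c)"
proof -
  define T where "T c = inverse (qpoch_inf (fps_X ^ c) (fps_X ^ m))" for c
  have nonneg: "nonneg_fps (T d)" if "d > 0" for d
    unfolding T_def using that assms(2) by (rule nonneg_inverse_qpoch_inf)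
  have T0: "fps_nth (T c) 0 = 1"
    using has_prod_qpoch_inf(2)[of "fps_X ^ c" "fps_X ^ m"] assms by (simp add: T_def)
  have "fps_nth (T c) c = fps_nth (T (c + m)) c + fps_nth (T c) 0"
    using arg_cong[OF inverse_qpoch_inf_rec[OF assms, folded T_def], of "\<lambda>f. fps_nth f c"]
    by (simp add: fps_X_power_mult_nth)
  moreover have "fps_nth (T (c + m)) c \<ge> 0"
    using nonneg[of "c + m"] assms by (simp add: nonneg_fps_def)
  ultimately have "fps_nth (T c) c \<ge> 1"
    using T0 by simp
  then show ?thesis
    using nonneg[OF assms(1)] T0 assms(1) by (auto simp: nonneg_fps_def T_def)
qed

theorem theorem1p7:
  fixes a b m n :: nat
  assumes "a > 0" and "b > 0" and "m > 0"
    and "b dvd a"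
    and "n < a + 2 * m"
  shows "fps_nth (F a b m) n \<ge> 0"
proof -
  define A where "A = head_factor a b"
  define H where "H = inverse (qpoch_inf (fps_X ^ (b + m)) (fps_X ^ m))"
  have "nonneg_fps (A * (H - 1 - fps_X ^ (b + m)) + A
      + fps_X ^ m * (A - 1 - fps_X ^ (a + b)))"
    unfolding A_def H_def using assms
    by (intro nonneg_fps_add nonneg_fps_mult nonneg_fps_X_power nonneg_head_factor
        nonneg_head_factor_minus nonneg_inverse_qpoch_inf_minus) auto
  \<comment> \<open>By the premise \<open>v * (1 + u * w)\<close> is
    \<open>v * (1 + u) * (1 - w) * A\<close>; its part without the factor \<open>u\<close> cancels
    \<open>v * (1 - w) * A\<close>.\<close>
  moreover have "A * (H - 1 - w * v) + A + v * (A - 1 - u * w) = A * H - u * v * (1 - w) * A"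
    if "(1 + u) * (1 - w) * A = 1 + u * w" for u v w
    using that by algebra
  from this[OF head_factor_mult[OF assms(1,2), folded A_def, unfolded power_add]]
  have "A * (H - 1 - fps_X ^ (b + m)) + A + fps_X ^ m * (A - 1 - fps_X ^ (a + b)) =
      A * H - fps_X ^ (a + m) * (1 - fps_X ^ b) * A"
    by (simp only: power_add)
  ultimately have "fps_nth (A * H - fps_X ^ (a + m) * (1 - fps_X ^ b) * A) n \<ge> 0"
    by (simp add: nonneg_fps_def)
  \<comment> \<open>The combination is nonnegative in every degree; the bound on \<open>n\<close>
    lets the congruence carry this over to \<open>F\<close>.\<close>
  moreover have "fps_nth (F a b m) n =
      fps_nth (A * H - fps_X ^ (a + m) * (1 - fps_X ^ b) * A) n"
    using F_cong[OF assms(1-3), folded A_def H_def] assms(5)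
    by (simp add: fps_X_power_dvd_iff)
  ultimately show ?thesis by simp
qed

end
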